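(* There is no formula $\textsc{MinimumSR}(x,y)$ of $\textsc{FOIL}$ such that, for every decision tree $\mathcal{T}$, every instance $\mathbf{e}$ and every partial instance $\mathbf{e}'$ of dimension $\dim(\mathcal{T})$, we have $\mathcal{T} \models \textsc{MinimumSR}(\mathbf{e},\mathbf{e}')$ if and only if $\mathbf{e}'$ is a minimum sufficient reason for $\mathbf{e}$ over $\mathcal{T}$.
   Context: A model of dimension $n$ is a Boolean function $\mathcal{M}:\{0,1\}^n\to\{0,1\}$. A partial instance of dimension $n$ is a tuple $\mathbf{e}\in\{0,1,\bot\}^n$ ($\bot$ = undefined); an instance is a partial instance in $\{0,1\}^n$. Write $\mathbf{e}_\bot=\{i\mid \mathbf{e}[i]=\bot\}$. $\mathbf{e}_1$ is subsumed by $\mathbf{e}_2$ if $\mathbf{e}_1[i]=\mathbf{e}_2[i]$ for every $i$ with $\mathbf{e}_1[i]\neq\bot$; the instances subsuming $\mathbf{e}$ are its completions. A decision tree of dimension $n$ is a rooted directed binary tree whose leaves are labeled $\mathsf{true}$ or $\mathsf{false}$, whose internal nodes are labeled by features in $\{1,\dots,n\}$ with two outgoing edges labeled $0$ and $1$, and in which no feature repeats along a root-to-leaf path; it classifies an instance $\mathbf{e}$ by following at each node labeled $j$ the edge labeled $\mathbf{e}[j]$, giving $\mathcal{T}(\mathbf{e})=1$ iff the reached leaf is labeled $\mathsf{true}$. $\textsc{FOIL}$ is first-order logic over the vocabulary $\{\textsc{Pos},\subseteq\}$; a model $\mathcal{M}$ of dimension $n$ is interpreted as the structure with domain $\{0,1,\bot\}^n$,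 where $\textsc{Pos}$ holds exactly for instances $\mathbf{e}\in\{0,1\}^n$ with $\mathcal{M}(\mathbf{e})=1$ and $\subseteq$ is the subsumption relation; $\mathcal{M}\models\varphi(\mathbf{e}_1,\dots,\mathbf{e}_k)$ means this structure satisfies $\varphi$ under the assignment. A sufficient reason for an instance $\mathbf{e}$ over $\mathcal{T}$ is a partial instance $\mathbf{e}'$ subsumed by $\mathbf{e}$ such that every completion $\mathbf{e}''$ of $\mathbf{e}'$ has $\mathcal{T}(\mathbf{e}'')=\mathcal{T}(\mathbf{e})$. It is minimum if there is no sufficient reason $\mathbf{e}''$ for $\mathbf{e}$ over $\mathcal{T}$ with $|\mathbf{e}''_\bot|>|\mathbf{e}'_\bot|$. *)

theory Defs
  imports Main
begin

text \<open>
  \<^term>\<open>None\<close> encodes the undefined value \<open>\<bottom>\<close>. Features are indexed by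
  \<open>0, \<dots>, n - 1\<close>, in accordance with list indexing.
\<close>

type_synonym pinst = "bool option list"

definition partial_instances :: "nat \<Rightarrow> pinst set" where
  "partial_instances n = {e. length e = n}"

definition instances :: "nat \<Rightarrow> pinst set" where
  "instances n = {e. length e = n \<and> None \<notin> set e}"

definition undef_positions :: "nat \<Rightarrow> pinst \<Rightarrow> nat set" where
  "undef_positions n e = {i. i < n \<and> e ! i = None}"

definition subsumed :: "nat \<Rightarrow> pinst \<Rightarrow> pinst \<Rightarrow> bool" where
  "subsumed n e1 e2 \<longleftrightarrow> (\<forall>i<n. e1 ! i \<noteq> None \<longrightarrow> e1 ! i = e2 ! i)"

definition completions :: "nat \<Rightarrow> pinst \<Rightarrow> pinst set" where
  "completions n e = {e'. e' \<in> instances n \<and> subsumed n e e'}"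

text \<open>A model of dimension \<open>n\<close>; only its values on \<^term>\<open>instances n\<close> are relevant.\<close>

type_synonym model = "pinst \<Rightarrow> bool"

text \<open>In \<open>Node j l r\<close>, the edge labeled 0 leads to \<open>l\<close> and the edge labeled 1 to \<open>r\<close>.\<close>

datatype dtree = Leaf bool | Node nat dtree dtree

primrec features :: "dtree \<Rightarrow> nat set" where
  "features (Leaf b) = {}"
| "features (Node j l r) = insert j (features l \<union> features r)"

primrec decision_tree :: "nat \<Rightarrow> dtree \<Rightarrow> bool" where
  "decision_tree n (Leaf b) \<longleftrightarrow> True"
| "decision_tree n (Node j l r) \<longleftrightarrow>
     j < n \<and> j \<notin> features l \<and> j \<notin> features r \<and> decision_tree n l \<and> decision_tree n r"

primrec classify :: "dtree \<Rightarrow> model" where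
  "classify (Leaf b) e = b"
| "classify (Node j l r) e = (if e ! j = Some True then classify r e else classify l e)"

datatype foil =
    FPos nat
  | FSub nat nat
  | FEq nat nat
  | FNeg foil
  | FConj foil foil
  | FDisj foil foil
  | FEx nat foil
  | FAll nat foil

primrec free_vars :: "foil \<Rightarrow> nat set" where
  "free_vars (FPos x) = {x}"
| "free_vars (FSub x y) = {x, y}"
| "free_vars (FEq x y) = {x, y}"
| "free_vars (FNeg \<phi>) = free_vars \<phi>"
| "free_vars (FConj \<phi> \<psi>) = free_vars \<phi> \<union> free_vars \<psi>"
| "free_vars (FDisj \<phi> \<psi>) = free_vars \<phi> \<union> free_vars \<psi>"
| "free_vars (FEx x \<phi>) = free_vars \<phi> - {x}"
| "free_vars (FAll x \<phi>) = free_vars \<phi> - {x}"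

primrec sat :: "nat \<Rightarrow> model \<Rightarrow> (nat \<Rightarrow> pinst) \<Rightarrow> foil \<Rightarrow> bool" where
  "sat n M v (FPos x) \<longleftrightarrow> v x \<in> instances n \<and> M (v x)"
| "sat n M v (FSub x y) \<longleftrightarrow> subsumed n (v x) (v y)"
| "sat n M v (FEq x y) \<longleftrightarrow> v x = v y"
| "sat n M v (FNeg \<phi>) \<longleftrightarrow> \<not> sat n M v \<phi>"
| "sat n M v (FConj \<phi> \<psi>) \<longleftrightarrow> sat n M v \<phi> \<and> sat n M v \<psi>"
| "sat n M v (FDisj \<phi> \<psi>) \<longleftrightarrow> sat n M v \<phi> \<or> sat n M v \<psi>"
| "sat n M v (FEx x \<phi>) \<longleftrightarrow> (\<exists>e\<in>partial_instances n. sat n M (v(x := e)) \<phi>)"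
| "sat n M v (FAll x \<phi>) \<longleftrightarrow> (\<forall>e\<in>partial_instances n. sat n M (v(x := e)) \<phi>)"

definition sufficient_reason :: "nat \<Rightarrow> model \<Rightarrow> pinst \<Rightarrow> pinst \<Rightarrow> bool" where
  "sufficient_reason n M e e' \<longleftrightarrow>
     e' \<in> partial_instances n \<and> subsumed n e' e \<and> (\<forall>e''\<in>completions n e'. M e'' = M e)"

definition minimum_sufficient_reason :: "nat \<Rightarrow> model \<Rightarrow> pinst \<Rightarrow> pinst \<Rightarrow> bool" where
  "minimum_sufficient_reason n M e e' \<longleftrightarrow>
     sufficient_reason n M e e' \<and>
     \<not> (\<exists>e''. sufficient_reason n M e e'' \<and>
              card (undef_positions n e'') > card (undef_positions n e'))"

end

theory Submission
  imports Defs "HOL-Library.Cardinality"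
begin

text \<open>
  Split the features into two blocks and let the model accept an instance iff one of the blocks is
  constantly 1. For the all-ones instance, fixing the first block is a minimum sufficient reason
  iff the first block is not larger than the second. An Ehrenfeucht-Fraisse argument shows that
  FOIL cannot compare the block sizes: all atoms only depend on which types (the block of a
  position together with the values of all variables there) are realised by some position, and the
  value chosen by a quantifier refines each type into three. Hence a formula only sees
  the number of positions of each type up to a threshold, which triples with each quantifier.
\<close>

section \<open>Counting up to a threshold\<close>

text \<open>This is \<open>min m a = min m b\<close>: counting with truncation at
  \<open>m\<close>.\<close>

definition eq_upto :: "nat \<Rightarrow> nat \<Rightarrow> nat \<Rightarrow> bool" where
  "eq_upto m a b \<longleftrightarrow> a = b \<or> (m \<le> a \<and> m \<le> b)"

lemma eq_upto_sym: "eq_upto m a b \<Longrightarrow> eq_upto m b a"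
  by (auto simp: eq_upto_def)

lemma eq_upto_mono: "eq_upto m a b \<Longrightarrow> k \<le> m \<Longrightarrow> eq_upto k a b"
  by (auto simp: eq_upto_def)

lemma eq_upto_add: "eq_upto m a b \<Longrightarrow> eq_upto m c d \<Longrightarrow> eq_upto m (a + c) (b + d)"
  by (auto simp: eq_upto_def)

lemma eq_upto_sum:
  assumes "\<And>t. t \<in> S \<Longrightarrow> eq_upto m (f t) (g t)"
  shows "eq_upto m (sum f S) (sum g S)"
  using assms
proof (induction S rule: infinite_finite_induct)
  case (insert t S)
  then show ?case by (simp add: eq_upto_add)
qed (auto simp: eq_upto_def)

definition type_count :: "nat \<Rightarrow> (nat \<Rightarrow> 'c) \<Rightarrow> 'c \<Rightarrow> nat" where
  "type_count n \<kappa> t = card {i. i < n \<and> \<kappa> i = t}"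

definition types_equiv :: "nat \<Rightarrow> nat \<Rightarrow> (nat \<Rightarrow> 'c) \<Rightarrow> nat \<Rightarrow> (nat \<Rightarrow> 'c) \<Rightarrow> bool" where
  "types_equiv m n \<kappa> n' \<kappa>' \<longleftrightarrow> (\<forall>t. eq_upto m (type_count n \<kappa> t) (type_count n' \<kappa>' t))"

lemma types_equiv_sym: "types_equiv m n \<kappa> n' \<kappa>' \<Longrightarrow> types_equiv m n' \<kappa>' n \<kappa>"
  by (auto simp: types_equiv_def intro: eq_upto_sym)

lemma types_equiv_mono: "types_equiv m n \<kappa> n' \<kappa>' \<Longrightarrow> k \<le> m \<Longrightarrow> types_equiv k n \<kappa> n' \<kappa>'"
  by (auto simp: types_equiv_def intro: eq_upto_mono)

lemma type_count_cong: "(\<And>i. i < n \<Longrightarrow> \<kappa> i = \<mu> i) \<Longrightarrow> type_count n \<kappa> t = type_count n \<mu> t"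
  unfolding type_count_def by (rule arg_cong[where f = card]) auto

lemma types_equiv_cong:
  assumes "types_equiv m n \<kappa> n' \<kappa>'"
    and "\<And>i. i < n \<Longrightarrow> \<kappa> i = \<mu> i" and "\<And>i. i < n' \<Longrightarrow> \<kappa>' i = \<mu>' i"
  shows "types_equiv m n \<mu> n' \<mu>'"
  using assms type_count_cong[of n \<kappa> \<mu>] type_count_cong[of n' \<kappa>' \<mu>']
  by (simp add: types_equiv_def)

text \<open>The positions whose type is sent to \<open>s\<close> are the disjoint union of the
  classes of the types above \<open>s\<close>. The finite set \<open>S\<close> of relevant types
  keeps the sum finite when the type space is infinite.\<close>

lemma type_count_comp:
  assumes "finite S" and "\<kappa> ` {..<n} \<subseteq> S"
  shows "type_count n (\<lambda>i. g (\<kappa> i)) s = (\<Sum>t\<in>{t \<in> S. g t = s}. type_count n \<kappa> t)"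
proof -
  have "{i. i < n \<and> g (\<kappa> i) = s} = (\<Union>t\<in>{t \<in> S. g t = s}. {i. i < n \<and> \<kappa> i = t})"
    using assms(2) by auto
  then show ?thesis
    unfolding type_count_def using assms(1) by (simp, subst card_UN_disjoint) auto
qed

text \<open>Coarsening types by \<open>g\<close> only adds up counts, and agreement up to
  \<open>m\<close> survives addition.\<close>

lemma types_equiv_comp:
  assumes "types_equiv m n \<kappa> n' \<kappa>'"
  shows "types_equiv m n (\<lambda>i. g (\<kappa> i)) n' (\<lambda>i. g (\<kappa>' i))"
proof -
  define S where "S = \<kappa> ` {..<n} \<union> \<kappa>' ` {..<n'}"
  have "finite S" "\<kappa> ` {..<n} \<subseteq> S" "\<kappa>' ` {..<n'} \<subseteq> S"
    by (auto simp: S_def)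
  then show ?thesis
    using assms by (auto simp: types_equiv_def type_count_comp[of S] intro!: eq_upto_sum)
qed

text \<open>A universal statement says that the number of violating positions is 0, and a threshold
  of at least 1 distinguishes 0 from positive counts.\<close>

lemma types_equiv_all:
  assumes "types_equiv m n \<kappa> n' \<kappa>'" and "1 \<le> m"
  shows "(\<forall>i<n. P (\<kappa> i)) \<longleftrightarrow> (\<forall>i<n'. P (\<kappa>' i))"
proof -
  have "(\<forall>i<k. P (\<mu> i)) \<longleftrightarrow> type_count k (\<lambda>i. P (\<mu> i)) False = 0" for k \<mu>
    by (auto simp: type_count_def)
  moreover have "eq_upto m (type_count n (\<lambda>i. P (\<kappa> i)) False)
      (type_count n' (\<lambda>i. P (\<kappa>' i)) False)"
    using types_equiv_comp[OF assms(1), of P] by (simp add: types_equiv_def)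
  ultimately show ?thesis
    using assms(2) by (auto simp: eq_upto_def)
qed

section \<open>Answering a refinement of types\<close>

text \<open>\<open>X\<close> is in bijection with a disjoint union of blocks of \<open>c b\<close>
  points; \<open>f\<close> reads off the block.\<close>

lemma exists_fun_with_fibre_cards:
  fixes c :: "'b::finite \<Rightarrow> nat"
  assumes "finite X" and "sum c UNIV = card X"
  shows "\<exists>f. \<forall>b. card {i \<in> X. f i = b} = c b"
proof -
  have "card X = card (Sigma UNIV (\<lambda>b. {..<c b}))"
    using assms by simp
  then obtain h where h: "bij_betw h X (Sigma UNIV (\<lambda>b. {..<c b}))"
    using assms(1) finite_same_card_bij[of X "Sigma UNIV (\<lambda>b. {..<c b})"] by auto
  have "card {i \<in> X. fst (h i) = b} = c b" for b
  proof -
    have "h ` {i \<in> X. fst (h i) = b} = {p \<in> h ` X. fst p = b}" by auto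
    also have "\<dots> = {b} \<times> {..<c b}"
      unfolding bij_betw_imp_surj_on[OF h] by auto
    finally have "h ` {i \<in> X. fst (h i) = b} = {b} \<times> {..<c b}" .
    moreover have "inj_on h {i \<in> X. fst (h i) = b}"
      using bij_betw_imp_inj_on[OF h] by (rule inj_on_subset) auto
    ultimately show ?thesis
      using card_image[of h "{i \<in> X. fst (h i) = b}"] by simp
  qed
  then show ?thesis by (intro exI[of _ "\<lambda>i. fst (h i)"]) simp
qed

lemma sum_fibre_cards:
  fixes f :: "'a \<Rightarrow> 'b::finite"
  assumes "finite X"
  shows "(\<Sum>b\<in>UNIV. card {i \<in> X. f i = b}) = card X"
proof -
  have "X = (\<Union>b. {i \<in> X. f i = b})" by auto
  moreover have "card (\<Union>b. {i \<in> X. f i = b}) = (\<Sum>b\<in>UNIV. card {i \<in> X. f i = b})"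
    using assms by (intro card_UN_disjoint) auto
  ultimately show ?thesis by simp
qed

text \<open>The answer inside a single type. For equal sizes the fibre sizes are copied. Otherwise
  both sets are large, so all fibres but one can be truncated at \<open>m\<close> while the
  remaining one takes up the rest of \<open>Y\<close>.\<close>

lemma eq_upto_split:
  fixes f :: "'a \<Rightarrow> 'b::finite"
  assumes X: "finite X" and Y: "finite Y" and eq: "eq_upto (CARD('b) * m) (card X) (card Y)"
  shows "\<exists>g. \<forall>b. eq_upto m (card {i \<in> X. f i = b}) (card {i \<in> Y. g i = b})"
proof -
  let ?d = "\<lambda>b. card {i \<in> X. f i = b}"
  have "\<exists>c. sum c UNIV = card Y \<and> (\<forall>b. eq_upto m (?d b) (c b))"
  proof (cases "card X = card Y")
    case True
    then show ?thesis
      using sum_fibre_cards[OF X, of f] by (intro exI[of _ ?d]) (auto simp: eq_upto_def)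
  next
    case False
    then have big: "CARD('b) * m \<le> card X" "CARD('b) * m \<le> card Y"
      using eq by (auto simp: eq_upto_def)
    \<comment> \<open>Pigeonhole: if all fibres were smaller than \<open>m\<close>, then
      \<open>X\<close> would have fewer than \<open>CARD('b) * m\<close> elements.\<close>
    obtain b0 where b0: "m \<le> ?d b0"
    proof (rule ccontr)
      assume "\<not> thesis"
      then have "?d b < m" for b using that not_le by blast
      then have "sum ?d UNIV < (\<Sum>b\<in>(UNIV::'b set). m)" by (intro sum_strict_mono) auto
      then show False using big(1) sum_fibre_cards[OF X, of f] by simp
    qed
    define s where "s = (\<Sum>b\<in>UNIV - {b0}. min m (?d b))"
    \<comment> \<open>The fibre over \<open>b0\<close> absorbs what is left of \<open>Y\<close>;
      this is at least \<open>m\<close> because the truncated fibres use at most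
      \<open>(CARD('b) - 1) * m\<close> elements.\<close>
    define c where "c = (\<lambda>b. min m (?d b))(b0 := card Y - s)"
    have "s \<le> (\<Sum>b\<in>UNIV - {b0}. m)"
      unfolding s_def by (rule sum_mono) simp
    also have "\<dots> = (CARD('b) - 1) * m"
      by (simp add: card_Diff_singleton)
    finally have "s + m \<le> (CARD('b) - 1) * m + m" by simp
    also have "\<dots> = CARD('b) * m"
      by (metis Suc_diff_1 add.commute finite mult_Suc zero_less_card_finite)
    finally have s: "s + m \<le> card Y" using big(2) by simp
    have "(\<Sum>b\<in>UNIV - {b0}. c b) = s"
      unfolding s_def by (rule sum.cong) (auto simp: c_def)
    then have "sum c UNIV = card Y"
      using s sum.remove[of UNIV b0 c] by (simp add: c_def)
    moreover have "eq_upto m (?d b) (c b)" for b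
      using b0 s by (auto simp: c_def eq_upto_def)
    ultimately show ?thesis by blast
  qed
  then obtain c where c: "sum c UNIV = card Y" "\<And>b. eq_upto m (?d b) (c b)" by blast
  with exists_fun_with_fibre_cards[OF Y c(1)] show ?thesis by metis
qed

text \<open>Each type is split separately, and the answers \<open>G t\<close> are glued by letting
  every position follow the answer for its own type.\<close>

lemma types_equiv_extend:
  fixes f :: "nat \<Rightarrow> 'b::finite"
  assumes "types_equiv (CARD('b) * m) n \<kappa> n' \<kappa>'"
  shows "\<exists>f'. types_equiv m n (\<lambda>i. (\<kappa> i, f i)) n' (\<lambda>i. (\<kappa>' i, f' i))"
proof -
  have "\<forall>t. \<exists>g. \<forall>b. eq_upto m (card {i \<in> {i. i < n \<and> \<kappa> i = t}. f i = b})
      (card {i \<in> {i. i < n' \<and> \<kappa>' i = t}. g i = b})"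
    using assms by (intro allI eq_upto_split) (auto simp: types_equiv_def type_count_def)
  from choice[OF this] obtain G where
    G: "\<And>t b. eq_upto m (card {i \<in> {i. i < n \<and> \<kappa> i = t}. f i = b})
      (card {i \<in> {i. i < n' \<and> \<kappa>' i = t}. G t i = b})"
    by auto
  have "type_count n (\<lambda>i. (\<kappa> i, f i)) (t, b) = card {i \<in> {i. i < n \<and> \<kappa> i = t}. f i = b}"
    and "type_count n' (\<lambda>i. (\<kappa>' i, G (\<kappa>' i) i)) (t, b)
      = card {i \<in> {i. i < n' \<and> \<kappa>' i = t}. G t i = b}" for t b
    unfolding type_count_def by (rule arg_cong[where f = card], auto)+
  then show ?thesis
    using G by (intro exI[of _ "\<lambda>i. G (\<kappa>' i) i"]) (simp add: types_equiv_def)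
qed

section \<open>The two-block model as a decision tree\<close>

definition two_block_model :: "nat \<Rightarrow> nat \<Rightarrow> model" where
  "two_block_model a n e \<longleftrightarrow>
     (\<forall>i<a. e ! i = Some True) \<or> (\<forall>i\<in>{a..<n}. e ! i = Some True)"

primrec all_ones_tree :: "nat list \<Rightarrow> dtree \<Rightarrow> dtree \<Rightarrow> dtree" where
  "all_ones_tree [] t f = t"
| "all_ones_tree (j # js) t f = Node j f (all_ones_tree js t f)"

lemma classify_all_ones_tree:
  "classify (all_ones_tree js t f) e =
     (if \<forall>j\<in>set js. e ! j = Some True then classify t e else classify f e)"
  by (induction js) auto

lemma features_all_ones_tree:
  "features (all_ones_tree js t f) \<subseteq> set js \<union> features t \<union> features f"
  by (induction js) auto

lemma decision_tree_all_ones_tree: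
  assumes "decision_tree n t" and "decision_tree n f" and "distinct js"
    and "set js \<subseteq> {..<n}" and "set js \<inter> (features t \<union> features f) = {}"
  shows "decision_tree n (all_ones_tree js t f)"
  using assms
proof (induction js)
  case (Cons j js)
  then show ?case using features_all_ones_tree[of js t f] by auto
qed simp

definition two_block_tree :: "nat \<Rightarrow> nat \<Rightarrow> dtree" where
  "two_block_tree a n = all_ones_tree [0..<a] (Leaf True)
     (all_ones_tree [a..<n] (Leaf True) (Leaf False))"

lemma classify_two_block_tree: "classify (two_block_tree a n) = two_block_model a n"
  by (auto simp: two_block_tree_def two_block_model_def classify_all_ones_tree fun_eq_iff)

text \<open>A failed test in the first block leads to the tests of the second one. No feature
  repeats on a path, as the blocks are disjoint.\<close>

lemma decision_tree_two_block_tree: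
  assumes "a \<le> n"
  shows "decision_tree n (two_block_tree a n)"
proof -
  have "features (all_ones_tree [a..<n] (Leaf True) (Leaf False)) \<subseteq> {a..<n}"
    using features_all_ones_tree[of "[a..<n]" "Leaf True" "Leaf False"] by simp
  then show ?thesis
    unfolding two_block_tree_def using assms by (intro decision_tree_all_ones_tree) auto
qed

section \<open>The Ehrenfeucht-Fraisse argument for FOIL\<close>

lemma sat_cong_free_vars:
  "(\<And>z. z \<in> free_vars \<phi> \<Longrightarrow> v z = w z) \<Longrightarrow> sat n M v \<phi> = sat n M w \<phi>"
proof (induction \<phi> arbitrary: v w)
  case (FNeg \<phi>)
  then show ?case by (metis free_vars.simps(4) sat.simps(4))
next
  case (FConj \<phi> \<psi>)
  then show ?case by (metis UnCI free_vars.simps(5) sat.simps(5))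
next
  case (FDisj \<phi> \<psi>)
  then show ?case by (metis UnCI free_vars.simps(6) sat.simps(6))
next
  case (FEx x \<phi>)
  then have "sat n M (v(x := e)) \<phi> = sat n M (w(x := e)) \<phi>" for e
    by (intro FEx.IH) auto
  then show ?case by simp
next
  case (FAll x \<phi>)
  then have "sat n M (v(x := e)) \<phi> = sat n M (w(x := e)) \<phi>" for e
    by (intro FAll.IH) auto
  then show ?case by simp
qed auto

text \<open>Recording the values of all variables, not just a tuple of selected ones, lets a
  quantifier act as a plain function update.\<close>

definition position_type :: "nat \<Rightarrow> (nat \<Rightarrow> pinst) \<Rightarrow> nat \<Rightarrow> bool \<times> (nat \<Rightarrow> bool option)" where
  "position_type a v i = (i < a, \<lambda>z. v z ! i)"

text \<open>The invariant of the game. A triple consists of the dimension, the boundary between the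
  two blocks and the assignment.\<close>

definition assignments_equiv ::
  "nat \<Rightarrow> nat \<times> nat \<times> (nat \<Rightarrow> pinst) \<Rightarrow> nat \<times> nat \<times> (nat \<Rightarrow> pinst) \<Rightarrow> bool" where
  "assignments_equiv m = (\<lambda>(n, a, v) (n', a', v').
     a \<le> n \<and> a' \<le> n' \<and> (\<forall>z. v z \<in> partial_instances n) \<and> (\<forall>z. v' z \<in> partial_instances n') \<and>
     types_equiv m n (position_type a v) n' (position_type a' v'))"

lemma assignments_equiv_sym:
  "assignments_equiv m A B \<Longrightarrow> assignments_equiv m B A"
  by (auto simp: assignments_equiv_def intro: types_equiv_sym)

lemma assignments_equiv_mono:
  "assignments_equiv m A B \<Longrightarrow> k \<le> m \<Longrightarrow> assignments_equiv k A B"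
  by (auto simp: assignments_equiv_def intro: types_equiv_mono)

text \<open>One round of the game; the factor 3 is the number of values in
  \<open>bool option\<close>.\<close>

lemma assignments_equiv_extend:
  assumes eq: "assignments_equiv (3 * m) (n, a, v) (n', a', v')"
    and e: "e \<in> partial_instances n"
  shows "\<exists>e'\<in>partial_instances n'. assignments_equiv m (n, a, v(x := e)) (n', a', v'(x := e'))"
proof -
  have "types_equiv (CARD(bool option) * m) n (position_type a v) n' (position_type a' v')"
    using eq by (simp add: assignments_equiv_def card_UNIV_option)
  then obtain f' where f': "types_equiv m n (\<lambda>i. (position_type a v i, e ! i))
      n' (\<lambda>i. (position_type a' v' i, f' i))"
    using types_equiv_extend by blast
  define e' where "e' = map f' [0..<n']"
  have "types_equiv m n (position_type a (v(x := e))) n' (position_type a' (v'(x := e')))"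
    by (rule types_equiv_cong,
        \<comment> \<open>The new type overwrites the old value of \<open>x\<close> by the chosen
          one. This may merge refined types, hence the coarsening lemma.\<close>
        rule types_equiv_comp[OF f', where g = "\<lambda>((c, h), b). (c, h(x := b))"])
      (auto simp: position_type_def e'_def fun_eq_iff)
  then show ?thesis
    using eq e by (intro bexI[of _ e']) (auto simp: assignments_equiv_def e'_def partial_instances_def)
qed

text \<open>The form in which atoms are transferred: each is a Boolean combination of statements
  about the types of all positions.\<close>

lemma assignments_equiv_all:
  assumes "assignments_equiv m (n, a, v) (n', a', v')" and "1 \<le> m"
  shows "(\<forall>i<n. P (i < a) (\<lambda>z. v z ! i)) \<longleftrightarrow> (\<forall>i<n'. P (i < a') (\<lambda>z. v' z ! i))"
  using types_equiv_all[of m n "position_type a v" n' "position_type a' v'" "\<lambda>(c, h). P c h"] assms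
  by (simp add: assignments_equiv_def position_type_def)

text \<open>The threshold depends on the formula alone: 1 for atoms, the maximum for binary
  connectives, and three times that of the body for quantifiers.\<close>

lemma sat_two_block_threshold:
  "\<exists>m\<ge>1. \<forall>n a v n' a' v'. assignments_equiv m (n, a, v) (n', a', v') \<longrightarrow>
     sat n (two_block_model a n) v \<phi> = sat n' (two_block_model a' n') v' \<phi>"
proof (induction \<phi>)
  case (FPos x)
  \<comment> \<open>With positions restricted to \<open>i < n\<close>, the second block is the
    negation of \<open>i < a\<close>, so that \<open>FPos\<close> becomes a combination of
    conditions on types.\<close>
  have pos: "v x \<in> instances n \<and> two_block_model a n (v x) \<longleftrightarrow> (\<forall>i<n. v x ! i \<noteq> None) \<and>
      ((\<forall>i<n. i < a \<longrightarrow> v x ! i = Some True) \<or> (\<forall>i<n. \<not> i < a \<longrightarrow> v x ! i = Some True))"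
    if "a \<le> n" "v x \<in> partial_instances n" for n a v
    using that by (auto simp: instances_def partial_instances_def two_block_model_def in_set_conv_nth)
  show ?case
  proof (intro exI[of _ 1] conjI allI impI)
    fix n a v n' a' v'
    assume eq: "assignments_equiv 1 (n, a, v) (n', a', v')"
    then have "a \<le> n" "v x \<in> partial_instances n" "a' \<le> n'" "v' x \<in> partial_instances n'"
      by (auto simp: assignments_equiv_def)
    then show "sat n (two_block_model a n) v (FPos x) = sat n' (two_block_model a' n') v' (FPos x)"
      unfolding sat.simps
      using pos assignments_equiv_all[OF eq, of "\<lambda>c h. h x \<noteq> None"]
        assignments_equiv_all[OF eq, of "\<lambda>c h. c \<longrightarrow> h x = Some True"]
        assignments_equiv_all[OF eq, of "\<lambda>c h. \<not> c \<longrightarrow> h x = Some True"]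
      by simp
  qed simp
next
  case (FSub x y)
  show ?case
  proof (intro exI[of _ 1] conjI allI impI)
    fix n a v n' a' v'
    assume eq: "assignments_equiv 1 (n, a, v) (n', a', v')"
    show "sat n (two_block_model a n) v (FSub x y) = sat n' (two_block_model a' n') v' (FSub x y)"
      using assignments_equiv_all[OF eq, of "\<lambda>c h. h x \<noteq> None \<longrightarrow> h x = h y"]
      by (simp add: subsumed_def)
  qed simp
next
  case (FEq x y)
  have eq_nth: "v x = v y \<longleftrightarrow> (\<forall>i<n. v x ! i = v y ! i)"
    if "assignments_equiv 1 (n, a, v) B" for n a v B
    using that by (cases B) (auto simp: assignments_equiv_def partial_instances_def list_eq_iff_nth_eq)
  show ?case
  proof (intro exI[of _ 1] conjI allI impI)
    fix n a v n' a' v'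
    assume eq: "assignments_equiv 1 (n, a, v) (n', a', v')"
    show "sat n (two_block_model a n) v (FEq x y) = sat n' (two_block_model a' n') v' (FEq x y)"
      using eq_nth[OF eq] eq_nth[OF assignments_equiv_sym[OF eq]]
        assignments_equiv_all[OF eq, of "\<lambda>c h. h x = h y"] by simp
  qed simp
next
  case (FNeg \<phi>)
  then show ?case by simp
next
  case (FConj \<phi> \<psi>)
  then obtain k l where "k \<ge> 1" and kl:
    "\<And>n a v n' a' v'. assignments_equiv k (n, a, v) (n', a', v') \<Longrightarrow>
       sat n (two_block_model a n) v \<phi> = sat n' (two_block_model a' n') v' \<phi>"
    "\<And>n a v n' a' v'. assignments_equiv l (n, a, v) (n', a', v') \<Longrightarrow>
       sat n (two_block_model a n) v \<psi> = sat n' (two_block_model a' n') v' \<psi>"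
    by metis
  have "sat n (two_block_model a n) v (FConj \<phi> \<psi>) = sat n' (two_block_model a' n') v' (FConj \<phi> \<psi>)"
    if "assignments_equiv (max k l) (n, a, v) (n', a', v')" for n a v n' a' v'
    using kl(1)[OF assignments_equiv_mono[OF that]] kl(2)[OF assignments_equiv_mono[OF that]]
    by simp
  then show ?case
    using \<open>k \<ge> 1\<close> by (intro exI[of _ "max k l"]) (simp del: sat.simps)
next
  case (FDisj \<phi> \<psi>)
  then obtain k l where "k \<ge> 1" and kl:
    "\<And>n a v n' a' v'. assignments_equiv k (n, a, v) (n', a', v') \<Longrightarrow>
       sat n (two_block_model a n) v \<phi> = sat n' (two_block_model a' n') v' \<phi>"
    "\<And>n a v n' a' v'. assignments_equiv l (n, a, v) (n', a', v') \<Longrightarrow>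
       sat n (two_block_model a n) v \<psi> = sat n' (two_block_model a' n') v' \<psi>"
    by metis
  have "sat n (two_block_model a n) v (FDisj \<phi> \<psi>) = sat n' (two_block_model a' n') v' (FDisj \<phi> \<psi>)"
    if "assignments_equiv (max k l) (n, a, v) (n', a', v')" for n a v n' a' v'
    using kl(1)[OF assignments_equiv_mono[OF that]] kl(2)[OF assignments_equiv_mono[OF that]]
    by simp
  then show ?case
    using \<open>k \<ge> 1\<close> by (intro exI[of _ "max k l"]) (simp del: sat.simps)
next
  case (FEx x \<phi>)
  then obtain k where "k \<ge> 1" and k:
    "\<And>n a v n' a' v'. assignments_equiv k (n, a, v) (n', a', v') \<Longrightarrow>
       sat n (two_block_model a n) v \<phi> = sat n' (two_block_model a' n') v' \<phi>"
    by metis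
  \<comment> \<open>One direction suffices, since the invariant is symmetric: a witness on one side
    is answered on the other.\<close>
  have "sat n' (two_block_model a' n') v' (FEx x \<phi>)"
    if "assignments_equiv (3 * k) (n, a, v) (n', a', v')" "sat n (two_block_model a n) v (FEx x \<phi>)"
    for n a v n' a' v'
    using assignments_equiv_extend[OF that(1)] that(2) k by (metis sat.simps(7))
  then show ?case
    using \<open>k \<ge> 1\<close> assignments_equiv_sym by (intro exI[of _ "3 * k"] conjI allI impI iffI) (simp, blast+)
next
  case (FAll x \<phi>)
  then obtain k where "k \<ge> 1" and k:
    "\<And>n a v n' a' v'. assignments_equiv k (n, a, v) (n', a', v') \<Longrightarrow>
       sat n (two_block_model a n) v \<phi> = sat n' (two_block_model a' n') v' \<phi>"
    by metis
  \<comment> \<open>Here the transfer runs backwards: an arbitrary \<open>e\<close> on the left is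
    answered by some \<open>e'\<close>, where the body holds by assumption.\<close>
  have "sat n (two_block_model a n) v (FAll x \<phi>)"
    if "assignments_equiv (3 * k) (n, a, v) (n', a', v')" "sat n' (two_block_model a' n') v' (FAll x \<phi>)"
    for n a v n' a' v'
    using assignments_equiv_extend[OF that(1)] that(2) k by (metis sat.simps(8))
  then show ?case
    using \<open>k \<ge> 1\<close> assignments_equiv_sym by (intro exI[of _ "3 * k"] conjI allI impI iffI) (simp, blast+)
qed

section \<open>Sufficient reasons for the all-ones instance\<close>

definition ones :: "nat \<Rightarrow> pinst" where
  "ones n = replicate n (Some True)"

definition ones_on :: "nat \<Rightarrow> nat set \<Rightarrow> pinst" where
  "ones_on n A = map (\<lambda>i. if i \<in> A then Some True else None) [0..<n]"

lemma ones_in_instances: "ones n \<in> instances n"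
  by (simp add: ones_def instances_def)

lemma ones_on_in_partial_instances: "ones_on n A \<in> partial_instances n"
  by (simp add: ones_on_def partial_instances_def)

lemma undef_positions_ones_on: "undef_positions n (ones_on n A) = {..<n} - A"
  by (auto simp: undef_positions_def ones_on_def split: if_splits)

lemma two_block_model_ones: "a \<le> n \<Longrightarrow> two_block_model a n (ones n)"
  by (auto simp: two_block_model_def ones_def)

text \<open>Every completion keeps a whole block constantly 1 and is therefore accepted.\<close>

lemma sufficient_reason_ones_on:
  assumes "a \<le> n" and "A = {..<a} \<or> A = {a..<n}"
  shows "sufficient_reason n (two_block_model a n) (ones n) (ones_on n A)"
proof -
  have "e ! i = Some True" if "e \<in> completions n (ones_on n A)" "i \<in> A" for e i
    using that assms by (auto simp: completions_def subsumed_def ones_on_def dest!: spec[of _ i])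
  then have "two_block_model a n e" if "e \<in> completions n (ones_on n A)" for e
    using that assms(2) by (auto simp: two_block_model_def)
  then show ?thesis
    using assms(1) by (simp add: sufficient_reason_def ones_on_in_partial_instances
        two_block_model_ones) (simp add: subsumed_def ones_on_def ones_def)
qed

text \<open>Completing \<open>e\<close> by zeros must still give an accepted instance. Its block of
  ones contains no undefined position of \<open>e\<close>, so these all lie in the other
  block.\<close>

lemma sufficient_reason_two_block_undef:
  assumes "a \<le> n" and sr: "sufficient_reason n (two_block_model a n) (ones n) e"
  shows "undef_positions n e \<subseteq> {..<a} \<or> undef_positions n e \<subseteq> {a..<n}"
proof -
  \<comment> \<open>Undefined entries become 0. An entry \<open>Some False\<close> cannot occur, as
    \<open>e\<close> is subsumed by \<open>ones n\<close>; so \<open>c\<close> is a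
    completion.\<close>
  define c where "c = map (\<lambda>b. Some (b = Some True)) e"
  have len: "length e = n" and sub: "subsumed n e (ones n)"
    using sr by (auto simp: sufficient_reason_def partial_instances_def)
  have "c \<in> completions n e"
    using len sub by (auto simp: c_def completions_def instances_def subsumed_def ones_def)
  then have "two_block_model a n c"
    using sr two_block_model_ones[OF assms(1)] by (simp add: sufficient_reason_def)
  then show ?thesis
    using assms(1) len by (auto simp: two_block_model_def c_def undef_positions_def)
      (metis atLeastLessThan_iff not_le option.distinct(1))+
qed

text \<open>A sufficient reason leaves at most \<open>max a (n - a)\<close> positions undefined.
  Fixing the first block leaves \<open>n - a\<close> of them undefined, fixing the second one leaves
  \<open>a\<close>.\<close>

lemma minimum_sufficient_reason_two_block:
  assumes "a \<le> n"
  shows "minimum_sufficient_reason n (two_block_model a n) (ones n) (ones_on n {..<a})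
    \<longleftrightarrow> a \<le> n - a"
proof -
  have card1: "card (undef_positions n (ones_on n {..<a})) = n - a"
    using assms by (simp add: undef_positions_ones_on card_Diff_subset)
  have card2: "card (undef_positions n (ones_on n {a..<n})) = a"
    using assms by (simp add: undef_positions_ones_on card_Diff_subset subset_eq)
  have "card (undef_positions n e) \<le> max a (n - a)"
    if "sufficient_reason n (two_block_model a n) (ones n) e" for e
    using sufficient_reason_two_block_undef[OF assms that]
      card_mono[of "{..<a}" "undef_positions n e"] card_mono[of "{a..<n}" "undef_positions n e"]
    by auto
  then show ?thesis
    using sufficient_reason_ones_on[OF assms] card1 card2
    unfolding minimum_sufficient_reason_def by (metis linorder_not_le max.absorb2)
qed

section \<open>Indistinguishable block sizes\<close>

text \<open>All positions of a block share one type. The second blocks have the same size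
  \<open>k\<close>, and the first blocks both reach the threshold.\<close>

lemma assignments_equiv_two_block:
  fixes m k x
  defines "v \<equiv> \<lambda>n a z. if z = x then ones n else ones_on n {..<a}"
  assumes "m \<le> a" and "m \<le> a'"
  shows "assignments_equiv m (a + k, a, v (a + k) a) (a' + k, a', v (a' + k) a')"
proof -
  have cnt: "type_count (b + k) (\<lambda>i. i < b) c = (if c then b else k)" for b c
  proof -
    have "{i. i < b + k \<and> (i < b) = c} = (if c then {..<b} else {b..<b + k})" by auto
    then show ?thesis by (simp add: type_count_def)
  qed
  have "types_equiv m (a + k) (\<lambda>i. i < a) (a' + k) (\<lambda>i. i < a')"
    using assms(2,3) by (auto simp: types_equiv_def eq_upto_def cnt)
  \<comment> \<open>The block bit determines the full type: \<open>x\<close> has value 1 everywhere,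
    every other variable has value 1 exactly on the first block.\<close>
  from types_equiv_comp[OF this, where
      g = "\<lambda>c. (c, \<lambda>z. if z = x \<or> c then Some True else None)"]
  have "types_equiv m (a + k) (position_type a (v (a + k) a))
      (a' + k) (position_type a' (v (a' + k) a'))"
    by (rule types_equiv_cong) (auto simp: position_type_def v_def ones_def ones_on_def fun_eq_iff)
  then show ?thesis
    by (auto simp: assignments_equiv_def v_def ones_on_in_partial_instances)
      (auto simp: ones_def partial_instances_def)
qed

theorem theorem1:
  shows "\<not> (\<exists>(\<phi> :: foil) (x :: nat) (y :: nat). x \<noteq> y \<and> free_vars \<phi> \<subseteq> {x, y} \<and>
           (\<forall>(n :: nat) (T :: dtree). decision_tree n T \<longrightarrow>
             (\<forall>e\<in>instances n. \<forall>e'\<in>partial_instances n.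
                sat n (classify T) ((\<lambda>_. undefined)(x := e, y := e')) \<phi>
                \<longleftrightarrow> minimum_sufficient_reason n (classify T) e e')))"
proof
  assume "\<exists>\<phi> x y. x \<noteq> y \<and> free_vars \<phi> \<subseteq> {x, y} \<and>
           (\<forall>n T. decision_tree n T \<longrightarrow>
             (\<forall>e\<in>instances n. \<forall>e'\<in>partial_instances n.
                sat n (classify T) ((\<lambda>_. undefined)(x := e, y := e')) \<phi>
                \<longleftrightarrow> minimum_sufficient_reason n (classify T) e e'))"
  then obtain \<phi> x y where "x \<noteq> y" and fv: "free_vars \<phi> \<subseteq> {x, y}" and
    \<phi>: "\<And>n T e e'. decision_tree n T \<Longrightarrow> e \<in> instances n \<Longrightarrow> e' \<in> partial_instances n \<Longrightarrow>
      sat n (classify T) ((\<lambda>_. undefined)(x := e, y := e')) \<phi>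
      \<longleftrightarrow> minimum_sufficient_reason n (classify T) e e'"
    by (elim exE conjE) blast
  \<comment> \<open>Variables other than \<open>x\<close> and \<open>y\<close> also get a value of
    length \<open>n\<close>, as the invariant demands; \<open>undefined\<close> need not have that
    length.\<close>
  define v where "v = (\<lambda>n a z. if z = x then ones n else ones_on n {..<a})"
  have sat_iff: "sat n (two_block_model a n) (v n a) \<phi> \<longleftrightarrow> a \<le> n - a" if "a \<le> n" for n a
  proof -
    have "sat n (two_block_model a n) (v n a) \<phi> \<longleftrightarrow>
      sat n (two_block_model a n) ((\<lambda>_. undefined)(x := ones n, y := ones_on n {..<a})) \<phi>"
      using fv \<open>x \<noteq> y\<close> by (intro sat_cong_free_vars) (auto simp: v_def)
    also have "\<dots> \<longleftrightarrow>
      minimum_sufficient_reason n (two_block_model a n) (ones n) (ones_on n {..<a})"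
      using \<phi>[OF decision_tree_two_block_tree[OF that] ones_in_instances
          ones_on_in_partial_instances] by (simp add: classify_two_block_tree)
    finally show ?thesis
      using minimum_sufficient_reason_two_block[OF that] by simp
  qed
  obtain m where m: "\<And>n a v n' a' v'. assignments_equiv m (n, a, v) (n', a', v') \<Longrightarrow>
      sat n (two_block_model a n) v \<phi> = sat n' (two_block_model a' n') v' \<phi>"
    using sat_two_block_threshold by metis
  \<comment> \<open>Blocks of sizes \<open>m\<close> and \<open>m\<close> against
    \<open>Suc m\<close> and \<open>m\<close>: the first block is no larger than the second only in
    the former case.\<close>
  have "assignments_equiv m (m + m, m, v (m + m) m) (Suc m + m, Suc m, v (Suc m + m) (Suc m))"
    unfolding v_def by (rule assignments_equiv_two_block) auto
  from m[OF this] show False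
    using sat_iff[of m "m + m"] sat_iff[of "Suc m" "Suc m + m"] by simp
qed

end
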